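(* For $N\in\mathbb{N}$ and real $x,y$, define \[ \mathcal{K}_{\mathrm{CUE}}(x,y;N)=\int_{U(N)}\Lambda_M(e^{-ix})\,\Lambda_{M^\dagger}(e^{iy})\,dM . \] Let $f$ be a function that is meromorphic in $\mathbb{C}$, holomorphic in the open unit disc $|z|<1$, and satisfies $f(z)=o(|z|^{N+1})$ as $|z|\to\infty$. Then for real $y$, \[ \lim_{N\to\infty}\int_0^{2\pi} f(e^{ix})\,\mathcal{K}_{\mathrm{CUE}}(x,y;N)\,dx = 2\pi f(e^{iy}). \]
   Context: $U(N)$ is the group of $N\times N$ unitary matrices with normalized Haar (probability) measure $dM$, $M^\dagger$ is the conjugate transpose of $M$, and for a unitary matrix $A$, $\Lambda_A(z)=\det(I-zA^{\dagger})$ is its characteristic polynomial (so that $\Lambda_M(e^{-ix})\Lambda_{M^\dagger}(e^{iy})=\det(I-e^{-ix}M^\dagger)\det(I-e^{iy}M)$).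
   Formalization: It is additionally assumed that, for the given y and all large N, the integral over [0,2π] exists; without this a pole of f on |z|=1, such as f(z)=1/(1-z), makes the integrals diverge and the limit undefined. *)

theory Defs
  imports
    "HOL-Probability.Probability"
    "HOL-Complex_Analysis.Complex_Analysis"
    "HOL-Library.Landau_Symbols"
    "Jordan_Normal_Form.Schur_Decomposition"
begin

hide_const (open) Determinants.det

definition unitary_group :: "nat \<Rightarrow> complex mat set" where
  "unitary_group n = {M \<in> carrier_mat n n. M * mat_adjoint M = 1\<^sub>m n \<and> mat_adjoint M * M = 1\<^sub>m n}"

(* The type of matrices of arbitrary size carries no topology. The Borel sets of U(n), in the
   subspace topology of the n x n complex matrices, are the preimages under the entry map of the
   product sigma-algebra, which is the Borel sigma-algebra because the complex numbers are
   second countable. *)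
definition borel_unitary :: "nat \<Rightarrow> complex mat measure" where
  "borel_unitary n = vimage_algebra (unitary_group n)
     (\<lambda>M. \<lambda>ij\<in>{..<n} \<times> {..<n}. M $$ ij) (\<Pi>\<^sub>M ij\<in>{..<n} \<times> {..<n}. borel)"

(* Left invariance together with total mass 1 determines the measure: U(n) is compact. *)
definition haar_unitary :: "nat \<Rightarrow> complex mat measure \<Rightarrow> bool" where
  "haar_unitary n \<mu> \<longleftrightarrow> prob_space \<mu> \<and> sets \<mu> = sets (borel_unitary n) \<and>
     (\<forall>A\<in>unitary_group n. distr \<mu> \<mu> (\<lambda>M. A * M) = \<mu>)"

definition \<Lambda> :: "complex mat \<Rightarrow> complex \<Rightarrow> complex" where
  "\<Lambda> A z = det (1\<^sub>m (dim_row A) - z \<cdot>\<^sub>m mat_adjoint A)"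

definition K_CUE :: "complex mat measure \<Rightarrow> real \<Rightarrow> real \<Rightarrow> complex" where
  "K_CUE \<mu> x y = (LINT M|\<mu>. \<Lambda> M (cis (- x)) * \<Lambda> (mat_adjoint M) (cis y))"

lemma unitary_group_carrier: "M \<in> unitary_group n \<Longrightarrow> M \<in> carrier_mat n n"
  by (simp add: unitary_group_def)

lemma index_mat_adjoint:
  "i < dim_col A \<Longrightarrow> j < dim_row A \<Longrightarrow> mat_adjoint A $$ (i, j) = conjugate (A $$ (j, i))"
  by (simp add: mat_adjoint_def mat_of_rows_def)

lemma mat_adjoint_carrier:
  "A \<in> carrier_mat n m \<Longrightarrow> mat_adjoint A \<in> carrier_mat m n"
  by (auto simp: mat_adjoint_def)

lemma mat_adjoint_times:
  assumes "A \<in> carrier_mat n n" "(B :: complex mat) \<in> carrier_mat n n"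
  shows "mat_adjoint (A * B) = mat_adjoint B * mat_adjoint A"
proof (rule eq_matI)
  have dims: "dim_row (mat_adjoint A) = n" "dim_col (mat_adjoint A) = n"
     "dim_row (mat_adjoint B) = n" "dim_col (mat_adjoint B) = n"
    "dim_row (mat_adjoint (A*B)) = n" "dim_col (mat_adjoint (A*B)) = n"
    using assms by (auto simp: mat_adjoint_def)
  show "dim_row (mat_adjoint (A * B)) = dim_row (mat_adjoint B * mat_adjoint A)"
    "dim_col (mat_adjoint (A * B)) = dim_col (mat_adjoint B * mat_adjoint A)"
    using dims by auto
  fix i j assume "i < dim_row (mat_adjoint B * mat_adjoint A)"
    "j < dim_col (mat_adjoint B * mat_adjoint A)"
  then have "i < n" "j < n" using dims by auto
  then show "mat_adjoint (A * B) $$ (i, j) = (mat_adjoint B * mat_adjoint A) $$ (i, j)"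
    using assms dims
    by (auto simp: index_mat_adjoint scalar_prod_def mult.commute intro!: sum.cong)
qed

lemma unitary_group_times:
  assumes "A \<in> unitary_group n" "B \<in> unitary_group n"
  shows "A * B \<in> unitary_group n"
proof -
  have A: "A \<in> carrier_mat n n" "mat_adjoint A \<in> carrier_mat n n"
    and B: "B \<in> carrier_mat n n" "mat_adjoint B \<in> carrier_mat n n"
    using assms unitary_group_carrier mat_adjoint_carrier by blast+
  have "A * B * (mat_adjoint B * mat_adjoint A) = A * (B * mat_adjoint B) * mat_adjoint A"
    using A B by (simp add: assoc_mult_mat[of _ n n _ n _ n])
  moreover have "mat_adjoint B * mat_adjoint A * (A * B) = mat_adjoint B * (mat_adjoint A * A) * B"
    using A B by (simp add: assoc_mult_mat[of _ n n _ n _ n])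
  ultimately show ?thesis
    using assms A B by (auto simp: unitary_group_def mat_adjoint_times)
qed

lemma space_borel_unitary [simp]: "space (borel_unitary n) = unitary_group n"
  by (simp add: borel_unitary_def)

lemma measurable_entry:
  assumes "i < n" "j < n"
  shows "(\<lambda>M. M $$ (i, j)) \<in> borel_measurable (borel_unitary n)"
proof -
  have "(\<lambda>M. \<lambda>ij\<in>{..<n} \<times> {..<n}. M $$ ij) \<in>
      measurable (borel_unitary n) (\<Pi>\<^sub>M ij\<in>{..<n} \<times> {..<n}. borel :: complex measure)"
    unfolding borel_unitary_def by (rule measurable_vimage_algebra1) (auto simp: space_PiM)
  then have "(\<lambda>M. (\<lambda>ij\<in>{..<n} \<times> {..<n}. M $$ ij) (i, j)) \<in> borel_measurable (borel_unitary n)"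
    by (rule measurable_compose[OF _ measurable_component_singleton]) (use assms in auto)
  with assms show ?thesis by simp
qed

lemma measurable_unitary_times:
  assumes A: "A \<in> unitary_group n"
  shows "(\<lambda>M. A * M) \<in> measurable (borel_unitary n) (borel_unitary n)"
proof -
  have "(\<lambda>M. \<lambda>ij\<in>{..<n} \<times> {..<n}. (A * M) $$ ij) \<in>
      measurable (borel_unitary n) (\<Pi>\<^sub>M ij\<in>{..<n} \<times> {..<n}. borel :: complex measure)"
  proof (rule measurable_restrict)
    fix ij assume "ij \<in> {..<n} \<times> {..<n}"
    then obtain i j where ij: "ij = (i, j)" "i < n" "j < n" by auto
    have "(\<lambda>M. \<Sum>k<n. A $$ (i, k) * M $$ (k, j)) \<in> borel_measurable (borel_unitary n)"
      using ij by (intro borel_measurable_sum borel_measurable_times borel_measurable_const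
          measurable_entry) auto
    moreover have "(A * M) $$ ij = (\<Sum>k<n. A $$ (i, k) * M $$ (k, j))"
      if "M \<in> space (borel_unitary n)" for M
      using that ij unitary_group_carrier[OF A] unitary_group_carrier[of M n]
      by (auto simp: scalar_prod_def atLeast0LessThan intro!: sum.cong)
    ultimately show "(\<lambda>M. (A * M) $$ ij) \<in> borel_measurable (borel_unitary n)"
      by (subst measurable_cong) auto
  qed
  then show ?thesis
    unfolding borel_unitary_def[of n]
    by (intro measurable_vimage_algebra2)
       (use unitary_group_times[OF A] in \<open>auto simp: borel_unitary_def[of n]\<close>)
qed

end

theory Submission
  imports Defs
begin

text \<open>
  Expanding the characteristic polynomials gives
  \<open>det (I - w M) = \<Sum>\<^bsub>S\<^esub> (-w)\<^bsup>card S\<^esup> m\<^bsub>S\<^esub>(M)\<close> with the principal minors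
  \<open>m\<^bsub>S\<^esub>\<close>. Left multiplication by diagonal sign matrices shows that distinct principal minors are
  orthogonal in the Haar \<open>L\<^sup>2\<close> space; left multiplication by permutation matrices
  shows that all minors with columns \<open>S\<close> have the same second moment, and by the
  Cauchy-Binet identity this common value is \<open>1 / (n choose card S)\<close>. Hence the kernel is
  the geometric sum of \<open>e\<^bsup>ik(y-x)\<^esup>\<close> over \<open>k \<le> N\<close>.

  Two consecutive kernels have no common zero, so integrability excludes poles of \<open>f\<close> on the
  unit circle and \<open>f\<close> is holomorphic on a disc of radius larger than 1. The integral is then
  \<open>2\<pi>\<close> times the \<open>N\<close>-th Taylor partial sum of \<open>f\<close> at \<open>e\<^bsup>iy\<^esup>\<close>.
\<close>

section \<open>Minors\<close>

lemma ex_permutes_extending_inj: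
  assumes "finite A" "S \<subseteq> A" "inj_on f S" "f ` S \<subseteq> A"
  shows "\<exists>p. p permutes A \<and> (\<forall>i\<in>S. p i = f i)"
proof -
  have "card (A - S) = card (A - f ` S)"
    using card_Diff_subset[OF finite_subset[OF assms(2,1)] assms(2)]
      card_Diff_subset[OF finite_subset[OF assms(4,1)] assms(4)] card_image[OF assms(3)] by simp
  then obtain g where g: "bij_betw g (A - S) (A - f ` S)"
    using finite_same_card_bij[OF finite_Diff[OF assms(1)] finite_Diff[OF assms(1)]] by blast
  define p where "p i = (if i \<in> S then f i else if i \<in> A then g i else i)" for i
  have "bij_betw p (S \<union> (A - S)) (f ` S \<union> (A - f ` S))"
  proof (rule bij_betw_combine)
    show "bij_betw p S (f ` S)"
      using inj_on_imp_bij_betw[OF assms(3)] by (simp add: p_def cong: bij_betw_cong)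
    show "bij_betw p (A - S) (A - f ` S)"
      using g bij_betw_cong[of "A - S" p g] by (simp add: p_def)
  qed auto
  then have "bij_betw p A A"
    using assms(2,4) by (simp add: Un_absorb1)
  moreover have "p i = i" if "i \<notin> A" for i
    using that assms(2) by (auto simp: p_def)
  ultimately have "p permutes A"
    by (rule bij_imp_permutes)
  then show ?thesis by (auto simp: p_def)
qed

lemma sum_Pow_card:
  assumes "finite A"
  shows "(\<Sum>S\<in>Pow A. g (card S)) = (\<Sum>k\<le>card A. of_nat (card A choose k) * (g k :: 'a :: comm_semiring_1))"
proof -
  have "(\<Sum>k\<le>card A. of_nat (card A choose k) * g k) =
      (\<Sum>k\<le>card A. \<Sum>S\<in>{S \<in> Pow A. card S = k}. g (card S))"
    using assms by (intro sum.cong) (auto simp: n_subsets)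
  also have "\<dots> = (\<Sum>S\<in>Pow A. g (card S))"
    using assms by (intro sum.group) (auto intro: card_mono)
  finally show ?thesis ..
qed

section \<open>Leibniz formula for minors\<close>

text \<open>Using \<open>S\<close> itself as index set avoids renumbering to an initial segment.
  Minors with other rows arise by composing the row index with a map on \<open>S\<close>; the sign
  ambiguity of this choice cancels in a minor times its conjugate.\<close>

definition minor :: "nat set \<Rightarrow> (nat \<Rightarrow> nat \<Rightarrow> complex) \<Rightarrow> complex" where
  "minor S a = (\<Sum>p | p permutes S. of_int (sign p) * (\<Prod>i\<in>S. a i (p i)))"

lemma minor_cong: "(\<And>i j. i \<in> S \<Longrightarrow> j \<in> S \<Longrightarrow> a i j = b i j) \<Longrightarrow> minor S a = minor S b"
  unfolding minor_def by (intro sum.cong prod.cong arg_cong2[where f = "(*)"]) (auto dest: permutes_in_image)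

text \<open>In the Leibniz formula each factor is an entry of \<open>-w A\<close> plus a Kronecker
  delta. Expand the product, with \<open>S\<close> the set of factors where the entry is taken: the
  remaining deltas force \<open>p\<close> to fix everything outside \<open>S\<close>, which leaves
  the permutations of \<open>S\<close>.\<close>

lemma det_one_minus_smult:
  assumes A: "A \<in> carrier_mat n n"
  shows "det (1\<^sub>m n - w \<cdot>\<^sub>m A) =
    (\<Sum>S\<in>Pow {..<n}. (-w) ^ card S * minor S (\<lambda>i j. A $$ (i, j)))"
proof -
  let ?P = "{p. p permutes {..<n}}"
  have fP: "finite ?P" by (simp add: finite_permutations)
  have "det (1\<^sub>m n - w \<cdot>\<^sub>m A) = (\<Sum>p\<in>?P. of_int (sign p) *
      (\<Prod>i<n. (-w) * A $$ (i, p i) + of_bool (p i = i)))"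
  proof -
    have "(1\<^sub>m n - w \<cdot>\<^sub>m A) $$ (i, p i) = (-w) * A $$ (i, p i) + of_bool (p i = i)"
      if "p permutes {..<n}" "i < n" for p i
      using A that permutes_in_image[OF that(1), of i] by simp
    then show ?thesis
      using A by (subst det_def'[of _ n]) (simp_all add: atLeast0LessThan minus_carrier_mat)
  qed
  also have "\<dots> = (\<Sum>p\<in>?P. \<Sum>S\<in>Pow {..<n}. of_int (sign p) *
      ((\<Prod>i\<in>S. (-w) * A $$ (i, p i)) * (\<Prod>i\<in>{..<n} - S. of_bool (p i = i))))"
    by (simp only: prod_add[OF finite_lessThan] sum_distrib_left)
  also have "\<dots> = (\<Sum>S\<in>Pow {..<n}. \<Sum>p\<in>?P. of_int (sign p) *
      ((\<Prod>i\<in>S. (-w) * A $$ (i, p i)) * (\<Prod>i\<in>{..<n} - S. of_bool (p i = i))))"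
    by (rule sum.swap)
  also have "\<dots> = (\<Sum>S\<in>Pow {..<n}. (-w) ^ card S * minor S (\<lambda>i j. A $$ (i, j)))"
  proof (rule sum.cong[OF refl])
    fix S assume "S \<in> Pow {..<n}"
    then have S: "S \<subseteq> {..<n}" "finite S" by (auto dest: finite_subset)
    have fix_iff: "p permutes S \<longleftrightarrow> p permutes {..<n} \<and> (\<forall>i\<in>{..<n} - S. p i = i)" for p
      using permutes_subset[OF _ S(1), of p] permutes_not_in[of p S]
        permutes_superset[of p "{..<n}" S] by blast
    have "(\<Sum>p\<in>?P. of_int (sign p) *
        ((\<Prod>i\<in>S. (-w) * A $$ (i, p i)) * (\<Prod>i\<in>{..<n} - S. of_bool (p i = i)))) =
      (\<Sum>p | p permutes S. of_int (sign p) * (\<Prod>i\<in>S. (-w) * A $$ (i, p i)))"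
      using fP by (intro sum.mono_neutral_cong_right) (auto simp: fix_iff)
    then show "(\<Sum>p\<in>?P. of_int (sign p) *
        ((\<Prod>i\<in>S. (-w) * A $$ (i, p i)) * (\<Prod>i\<in>{..<n} - S. of_bool (p i = i)))) =
      (-w) ^ card S * minor S (\<lambda>i j. A $$ (i, j))"
      by (simp only: minor_def sum_distrib_left prod.distrib prod_constant mult.left_commute)
  qed
  finally show ?thesis .
qed

text \<open>Pass to inverse permutations, which have the same sign, and reindex each
  product.\<close>

lemma minor_transpose:
  assumes "finite S"
  shows "minor S (\<lambda>i j. a j i) = minor S a"
proof -
  have "minor S (\<lambda>i j. a j i) =
      (\<Sum>p | p permutes S. of_int (sign (inv_into UNIV p)) * (\<Prod>i\<in>S. a (inv_into UNIV p i) i))"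
    unfolding minor_def by (rule sum_permutations_inverse)
  also have "\<dots> = minor S a"
    unfolding minor_def
  proof (rule sum.cong[OF refl])
    fix p assume "p \<in> {p. p permutes S}"
    then have p: "p permutes S" by simp
    have "(\<Prod>i\<in>S. a (inv_into UNIV p i) i) = (\<Prod>i\<in>S. a (inv_into UNIV p (p i)) (p i))"
      by (rule prod.reindex_bij_betw[OF permutes_imp_bij[OF p], symmetric])
    moreover have "sign (inv_into UNIV p) = sign p"
      using p assms by (intro sign_inverse) (auto simp: permutation_permutes)
    ultimately show "of_int (sign (inv_into UNIV p)) * (\<Prod>i\<in>S. a (inv_into UNIV p i) i) =
        of_int (sign p) * (\<Prod>i\<in>S. a i (p i))"
      using p by (simp add: permutes_inverses)
  qed
  finally show ?thesis .
qed

text \<open>Two rows agree. Composing with the transposition of their indices keeps every product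
  and flips every sign, so the minor equals its own negative.\<close>

lemma minor_eq_0:
  assumes S: "finite S" and "\<not> inj_on f S"
  shows "minor S (\<lambda>i. M (f i)) = 0"
proof -
  obtain a b where ab: "a \<in> S" "b \<in> S" "a \<noteq> b" "f a = f b"
    using assms(2) by (auto simp: inj_on_def)
  define t where "t = Transposition.transpose a b"
  have t: "t permutes S" "sign t = - 1" "permutation t" "\<And>i. f (t i) = f i"
    using ab by (auto simp: t_def permutes_swap_id sign_swap_id permutation_swap_id
        Transposition.transpose_def)
  have "minor S (\<lambda>i. M (f i)) =
      (\<Sum>p | p permutes S. of_int (sign (p \<circ> t)) * (\<Prod>i\<in>S. M (f i) ((p \<circ> t) i)))"
    unfolding minor_def by (rule sum_permutations_compose_right[OF t(1)])
  also have "\<dots> = (\<Sum>p | p permutes S. - (of_int (sign p) * (\<Prod>i\<in>S. M (f i) (p i))))"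
  proof (rule sum.cong[OF refl])
    fix p assume "p \<in> {p. p permutes S}"
    then have "sign (p \<circ> t) = - sign p"
      using t S by (subst sign_compose) (auto intro: permutation_permutes[THEN iffD2])
    moreover have "(\<Prod>i\<in>S. M (f (t i)) (p (t i))) = (\<Prod>i\<in>S. M (f i) (p i))"
      by (rule prod.reindex_bij_betw[OF permutes_imp_bij[OF t(1)]])
    ultimately show "of_int (sign (p \<circ> t)) * (\<Prod>i\<in>S. M (f i) ((p \<circ> t) i)) =
        - (of_int (sign p) * (\<Prod>i\<in>S. M (f i) (p i)))"
      by (simp add: t(4))
  qed
  also have "\<dots> = - minor S (\<lambda>i. M (f i))"
    by (simp add: minor_def sum_negf)
  finally show ?thesis by simp
qed

text \<open>
  Cauchy-Binet for orthonormal columns. Summing over all functions instead of row subsets counts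
  each subset \<open>card S\<close> factorial times; the non-injective ones contribute nothing.
\<close>
lemma sum_minor_mult_cnj:
  fixes M :: "nat \<Rightarrow> nat \<Rightarrow> complex"
  assumes S: "finite S"
    and orth: "\<And>i j. i \<in> S \<Longrightarrow> j \<in> S \<Longrightarrow> (\<Sum>r<n. M r i * cnj (M r j)) = of_bool (i = j)"
  shows "(\<Sum>f\<in>S \<rightarrow>\<^sub>E {..<n}. minor S (\<lambda>i. M (f i)) * cnj (minor S (\<lambda>i. M (f i)))) = fact (card S)"
proof -
  let ?P = "{p. p permutes S}"
  have fP: "finite ?P" using S by (simp add: finite_permutations)
  have "(\<Sum>f\<in>S \<rightarrow>\<^sub>E {..<n}. minor S (\<lambda>i. M (f i)) * cnj (minor S (\<lambda>i. M (f i)))) =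
    (\<Sum>f\<in>S \<rightarrow>\<^sub>E {..<n}. \<Sum>p\<in>?P. \<Sum>q\<in>?P. of_int (sign p) * of_int (sign q) *
       (\<Prod>i\<in>S. M (f i) (p i) * cnj (M (f i) (q i))))"
    by (simp add: minor_def sum_product prod.distrib mult_ac)
  also have "\<dots> = (\<Sum>p\<in>?P. \<Sum>q\<in>?P. of_int (sign p) * of_int (sign q) *
       (\<Sum>f\<in>S \<rightarrow>\<^sub>E {..<n}. \<Prod>i\<in>S. M (f i) (p i) * cnj (M (f i) (q i))))"
    by (simp add: sum_distrib_left sum.swap[where A = "S \<rightarrow>\<^sub>E {..<n}"])
  \<comment> \<open>As \<open>f\<close> runs over all functions, the sum of products factors into a
    product of row sums, one inner product of columns \<open>p i\<close> and \<open>q i\<close> for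
    each \<open>i\<close>.\<close>
  also have "\<dots> = (\<Sum>p\<in>?P. \<Sum>q\<in>?P. of_int (sign p) * of_int (sign q) *
       (\<Prod>i\<in>S. \<Sum>r<n. M r (p i) * cnj (M r (q i))))"
    using S by (subst prod_sum_PiE) auto
  \<comment> \<open>By orthonormality only \<open>p = q\<close> survives, where the signs square to
    1.\<close>
  also have "\<dots> = (\<Sum>p\<in>?P. \<Sum>q\<in>?P. of_bool (p = q))"
  proof (intro sum.cong refl)
    fix p q assume pq: "p \<in> ?P" "q \<in> ?P"
    then have "(\<Prod>i\<in>S. \<Sum>r<n. M r (p i) * cnj (M r (q i))) = (\<Prod>i\<in>S. of_bool (p i = q i))"
      by (intro prod.cong refl orth) (auto simp: permutes_in_image)
    also have "\<dots> = of_bool (\<forall>i\<in>S. p i = q i)"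
      using S by (induction S rule: finite_induct) auto
    also have "(\<forall>i\<in>S. p i = q i) \<longleftrightarrow> p = q"
      using pq by (metis mem_Collect_eq permutes_not_in ext)
    finally show "of_int (sign p) * of_int (sign q) *
       (\<Prod>i\<in>S. \<Sum>r<n. M r (p i) * cnj (M r (q i))) = of_bool (p = q)"
      by (simp add: sign_def)
  qed
  also have "\<dots> = fact (card S)"
    using S fP by (simp add: card_permutations of_bool_def)
  finally show ?thesis .
qed

lemma minor_negate_row:
  assumes "finite S"
  shows "minor S (\<lambda>i j. (if i = k then - 1 else 1) * a i j) = (if k \<in> S then - 1 else 1) * minor S a"
  using assms by (simp add: minor_def prod.distrib sum_distrib_left prod.delta mult_ac)

section \<open>Moments of minors under Haar measure\<close>

lemma borel_measurable_cnj: "f \<in> borel_measurable M \<Longrightarrow> (\<lambda>x. cnj (f x)) \<in> borel_measurable M"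
  by (rule measurable_compose[OF _ borel_measurable_continuous_onI]) (auto intro!: continuous_intros)

lemma haar_unitary_prob_space: "haar_unitary n \<mu> \<Longrightarrow> prob_space \<mu>"
  and sets_haar_unitary: "haar_unitary n \<mu> \<Longrightarrow> sets \<mu> = sets (borel_unitary n)"
  by (simp_all add: haar_unitary_def)

lemma space_haar_unitary: "haar_unitary n \<mu> \<Longrightarrow> space \<mu> = unitary_group n"
  using sets_eq_imp_space_eq[OF sets_haar_unitary, of n \<mu>] by simp

text \<open>Left invariance as a change of variables. Measurability refers to
  \<open>borel_unitary n\<close>, which has the same sets as every Haar measure.\<close>

lemma integral_haar_unitary_times:
  fixes g :: "complex mat \<Rightarrow> 'a :: {banach, second_countable_topology}"
  assumes \<mu>: "haar_unitary n \<mu>" and A: "A \<in> unitary_group n"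
    and g: "g \<in> borel_measurable (borel_unitary n)"
  shows "(LINT M|\<mu>. g (A * M)) = (LINT M|\<mu>. g M)"
proof -
  have "(\<lambda>M. A * M) \<in> measurable \<mu> \<mu>"
    using measurable_unitary_times[OF A]
      measurable_cong_sets[OF sets_haar_unitary[OF \<mu>] sets_haar_unitary[OF \<mu>]] by blast
  moreover have "g \<in> borel_measurable \<mu>"
    using g measurable_cong_sets[OF sets_haar_unitary[OF \<mu>] refl] by blast
  ultimately have "(LINT M|distr \<mu> \<mu> (\<lambda>M. A * M). g M) = (LINT M|\<mu>. g (A * M))"
    by (rule integral_distr)
  then show ?thesis
    using \<mu> A by (simp add: haar_unitary_def)
qed

section \<open>Unitary matrices acting on rows, and bounds on entries\<close>

text \<open>Left multiplication replaces row \<open>i\<close> by \<open>d i\<close> times row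
  \<open>p i\<close>. The case \<open>p = id\<close> with signs \<open>d\<close> gives the sign
  matrices, and \<open>d = 1\<close> the permutation matrices.\<close>

definition signed_perm_mat :: "nat \<Rightarrow> (nat \<Rightarrow> nat) \<Rightarrow> (nat \<Rightarrow> complex) \<Rightarrow> complex mat" where
  "signed_perm_mat n p d = mat n n (\<lambda>(i, j). if j = p i then d i else 0)"

lemma signed_perm_mat_times:
  assumes "p permutes {..<n}" "M \<in> carrier_mat n m" "i < n" "j < m"
  shows "(signed_perm_mat n p d * M) $$ (i, j) = d i * M $$ (p i, j)"
proof -
  have "p i < n" using assms permutes_in_image[of p "{..<n}" i] by simp
  have "(signed_perm_mat n p d * M) $$ (i, j) =
      (\<Sum>k<n. if k = p i then d i * M $$ (k, j) else 0)"
    using assms unfolding signed_perm_mat_def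
    by (auto simp: scalar_prod_def atLeast0LessThan if_distrib[where f = "\<lambda>x. x * _"]
        simp del: sum.delta intro!: sum.cong)
  with \<open>p i < n\<close> show ?thesis by simp
qed

lemma signed_perm_mat_unitary:
  assumes p: "p permutes {..<n}" and d: "\<And>i. i < n \<Longrightarrow> d i * cnj (d i) = 1"
  shows "signed_perm_mat n p d \<in> unitary_group n"
proof -
  let ?U = "signed_perm_mat n p d"
  have U: "?U \<in> carrier_mat n n" "mat_adjoint ?U \<in> carrier_mat n n"
    by (auto simp: signed_perm_mat_def mat_adjoint_def)
  have "?U * mat_adjoint ?U = 1\<^sub>m n"
  proof (rule eq_matI)
    fix i k assume "i < dim_row (1\<^sub>m n :: complex mat)" "k < dim_col (1\<^sub>m n :: complex mat)"
    then have ik: "i < n" "k < n" by auto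
    then have "p i < n" "p i = p k \<longleftrightarrow> i = k"
      using p permutes_in_image[OF p, of i] by (auto dest: permutes_inj injD)
    then show "(?U * mat_adjoint ?U) $$ (i, k) = 1\<^sub>m n $$ (i, k)"
      using ik U d by (subst signed_perm_mat_times[OF p U(2)])
        (auto simp: index_mat_adjoint, auto simp: signed_perm_mat_def)
  qed (use U in auto)
  moreover from this have "mat_adjoint ?U * ?U = 1\<^sub>m n"
    using mat_mult_left_right_inverse[OF U] by blast
  ultimately show ?thesis
    using U by (simp add: unitary_group_def)
qed

text \<open>This is entry \<open>(j, i)\<close> of the adjoint of \<open>M\<close> times
  \<open>M\<close>, in the form that the Cauchy-Binet identity \<open>sum_minor_mult_cnj\<close>
  assumes.\<close>

lemma unitary_group_columns:
  assumes M: "M \<in> unitary_group n" and "i < n" "j < n"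
  shows "(\<Sum>r<n. M $$ (r, i) * cnj (M $$ (r, j))) = of_bool (i = j)"
proof -
  have c: "M \<in> carrier_mat n n" "mat_adjoint M \<in> carrier_mat n n"
    using M unitary_group_carrier mat_adjoint_carrier by blast+
  have "of_bool (i = j) = (mat_adjoint M * M) $$ (j, i)"
    using M assms by (auto simp: unitary_group_def)
  also have "\<dots> = (\<Sum>r<n. M $$ (r, i) * cnj (M $$ (r, j)))"
    using c assms(2,3)
    by (auto simp: scalar_prod_def atLeast0LessThan index_mat_adjoint mult.commute intro!: sum.cong)
  finally show ?thesis ..
qed

text \<open>Each column has Euclidean norm 1.\<close>

lemma unitary_group_norm_entry_le:
  assumes M: "M \<in> unitary_group n" and ij: "i < n" "j < n"
  shows "norm (M $$ (i, j)) \<le> 1"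
proof -
  have "complex_of_real (\<Sum>r<n. (norm (M $$ (r, j)))\<^sup>2) = 1"
    using unitary_group_columns[OF M ij(2) ij(2)]
    unfolding of_real_sum complex_norm_square by simp
  then have "(\<Sum>r<n. (norm (M $$ (r, j)))\<^sup>2) = 1"
    using of_real_eq_1_iff by blast
  moreover have "(norm (M $$ (i, j)))\<^sup>2 \<le> (\<Sum>r<n. (norm (M $$ (r, j)))\<^sup>2)"
    using ij by (intro member_le_sum) auto
  ultimately show ?thesis
    by (simp add: power_le_one_iff abs_square_le_1)
qed

abbreviation mat_minor :: "nat set \<Rightarrow> (nat \<Rightarrow> nat) \<Rightarrow> complex mat \<Rightarrow> complex" where
  "mat_minor S f M \<equiv> minor S (\<lambda>i j. M $$ (f i, j))"

lemma measurable_minor: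
  assumes "S \<subseteq> {..<n}" "f ` S \<subseteq> {..<n}"
  shows "mat_minor S f \<in> borel_measurable (borel_unitary n)"
  unfolding minor_def
  by (intro borel_measurable_sum borel_measurable_times borel_measurable_const
      borel_measurable_prod measurable_entry)
    (use assms in \<open>auto dest!: permutes_in_image[THEN iffD2]\<close>)

text \<open>Triangle inequality over the \<open>fact (card S)\<close> Leibniz terms, each of norm at
  most 1. Any bound independent of \<open>M\<close> would give integrability.\<close>

lemma norm_minor_le:
  assumes M: "M \<in> unitary_group n" and S: "S \<subseteq> {..<n}" "f ` S \<subseteq> {..<n}"
  shows "norm (mat_minor S f M) \<le> fact (card S)"
proof -
  have fin: "finite S" using S(1) finite_subset by blast
  have "norm (mat_minor S f M) \<le> (\<Sum>p | p permutes S. 1)"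
    unfolding minor_def
  proof (rule sum_norm_le)
    fix p assume p: "p \<in> {p. p permutes S}"
    have "(\<Prod>i\<in>S. norm (M $$ (f i, p i))) \<le> (\<Prod>i\<in>S. 1)"
    proof (rule prod_mono, intro conjI)
      fix i assume i: "i \<in> S"
      then have "p i \<in> S" using p permutes_in_image[of p S i] by blast
      with i S show "norm (M $$ (f i, p i)) \<le> 1"
        by (intro unitary_group_norm_entry_le[OF M]) auto
    qed auto
    then show "norm (complex_of_int (sign p) * (\<Prod>i\<in>S. M $$ (f i, p i))) \<le> 1"
      by (simp add: norm_mult sign_def flip: prod_norm)
  qed
  then show ?thesis using fin by (simp add: card_permutations)
qed

lemma integrable_minor_mult_cnj:
  assumes \<mu>: "haar_unitary n \<mu>"
    and S: "S \<subseteq> {..<n}" "f ` S \<subseteq> {..<n}" and T: "T \<subseteq> {..<n}" "g ` T \<subseteq> {..<n}"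
  shows "integrable \<mu> (\<lambda>M. mat_minor S f M * cnj (mat_minor T g M))"
proof -
  interpret prob_space \<mu> using \<mu> by (rule haar_unitary_prob_space)
  have [measurable]: "mat_minor S f \<in> borel_measurable \<mu>" "mat_minor T g \<in> borel_measurable \<mu>"
    using measurable_minor[OF S] measurable_minor[OF T]
    by (simp_all add: measurable_cong_sets[OF sets_haar_unitary[OF \<mu>] refl])
  show ?thesis
  proof (rule integrable_const_bound[where B = "fact (card S) * fact (card T)"])
    show "AE M in \<mu>. norm (mat_minor S f M * cnj (mat_minor T g M)) \<le> fact (card S) * fact (card T)"
      using norm_minor_le[OF _ S] norm_minor_le[OF _ T]
      by (intro AE_I2) (auto simp: space_haar_unitary[OF \<mu>] norm_mult intro!: mult_mono)
  qed (intro borel_measurable_times borel_measurable_cnj; measurable)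
qed

section \<open>Second moments of minors\<close>

text \<open>Negate a row \<open>k\<close> that lies in exactly one of \<open>S\<close> and
  \<open>T\<close>. Exactly one of the two minors changes sign, so by invariance the integral equals
  its own negative.\<close>

lemma integral_minor_mult_cnj_eq_0:
  assumes \<mu>: "haar_unitary n \<mu>" and S: "S \<subseteq> {..<n}" and T: "T \<subseteq> {..<n}" and "S \<noteq> T"
  shows "(LINT M|\<mu>. mat_minor S id M * cnj (mat_minor T id M)) = 0"
proof -
  obtain k where k: "k \<in> S \<longleftrightarrow> k \<notin> T" using \<open>S \<noteq> T\<close> by blast
  define D where "D = signed_perm_mat n id (\<lambda>i. if i = k then - 1 else 1)"
  have D: "D \<in> unitary_group n"
    unfolding D_def by (rule signed_perm_mat_unitary) (auto simp: permutes_id)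
  have minor: "mat_minor R id (D * M) = (if k \<in> R then - 1 else 1) * mat_minor R id M"
    if "M \<in> unitary_group n" "R \<subseteq> {..<n}" for M R
  proof -
    have "mat_minor R id (D * M) = minor R (\<lambda>i j. (if i = k then - 1 else 1) * M $$ (i, j))"
      using that unitary_group_carrier[OF that(1)] unfolding D_def
      by (intro minor_cong) (auto simp: signed_perm_mat_times[OF permutes_id] subset_iff)
    also have "\<dots> = (if k \<in> R then - 1 else 1) * mat_minor R id M"
      using that(2) by (subst minor_negate_row) (auto dest: finite_subset)
    finally show ?thesis .
  qed
  have "(LINT M|\<mu>. mat_minor S id M * cnj (mat_minor T id M)) =
      (LINT M|\<mu>. mat_minor S id (D * M) * cnj (mat_minor T id (D * M)))"
    using S T by (intro integral_haar_unitary_times[OF \<mu> D, symmetric] borel_measurable_times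
        borel_measurable_cnj measurable_minor) auto
  also have "\<dots> = (LINT M|\<mu>. - (mat_minor S id M * cnj (mat_minor T id M)))"
    using k S T minor
    by (intro Bochner_Integration.integral_cong) (auto simp: space_haar_unitary[OF \<mu>])
  finally show ?thesis by simp
qed

text \<open>Extend \<open>f\<close> to a permutation \<open>p\<close>. Row \<open>i\<close> of
  \<open>P * M\<close> is row \<open>f i\<close> of \<open>M\<close> for \<open>i\<close> in
  \<open>S\<close>, so invariance moves the chosen rows to \<open>S\<close>.\<close>

lemma integral_minor_mult_cnj_inj:
  assumes \<mu>: "haar_unitary n \<mu>" and S: "S \<subseteq> {..<n}" and f: "inj_on f S" "f ` S \<subseteq> {..<n}"
  shows "(LINT M|\<mu>. mat_minor S f M * cnj (mat_minor S f M)) =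
    (LINT M|\<mu>. mat_minor S id M * cnj (mat_minor S id M))"
proof -
  obtain p where p: "p permutes {..<n}" "\<And>i. i \<in> S \<Longrightarrow> p i = f i"
    using ex_permutes_extending_inj[OF finite_lessThan S f] by blast
  define P where "P = signed_perm_mat n p (\<lambda>i. 1)"
  have P: "P \<in> unitary_group n"
    unfolding P_def by (rule signed_perm_mat_unitary[OF p(1)]) simp
  have "mat_minor S f M = mat_minor S id (P * M)" if "M \<in> unitary_group n" for M
    using that unitary_group_carrier[OF that] S unfolding P_def
    by (intro minor_cong) (auto simp: signed_perm_mat_times[OF p(1)] p(2) subset_iff)
  then have "(LINT M|\<mu>. mat_minor S f M * cnj (mat_minor S f M)) =
      (LINT M|\<mu>. mat_minor S id (P * M) * cnj (mat_minor S id (P * M)))"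
    by (intro Bochner_Integration.integral_cong) (auto simp: space_haar_unitary[OF \<mu>])
  also have "\<dots> = (LINT M|\<mu>. mat_minor S id M * cnj (mat_minor S id M))"
    using S by (intro integral_haar_unitary_times[OF \<mu> P] borel_measurable_times
        borel_measurable_cnj measurable_minor) auto
  finally show ?thesis .
qed

text \<open>Integrate the Cauchy-Binet identity: the second moments over all row choices
  \<open>f\<close> add up to \<open>fact (card S)\<close>. Non-injective \<open>f\<close> contribute
  0 and all injective ones the same value, so dividing by the number of injections gives the
  claim.\<close>

lemma integral_minor_mult_cnj_self:
  assumes \<mu>: "haar_unitary n \<mu>" and S: "S \<subseteq> {..<n}"
  shows "(LINT M|\<mu>. mat_minor S id M * cnj (mat_minor S id M)) = 1 / (n choose card S)"
proof -
  interpret prob_space \<mu> using \<mu> by (rule haar_unitary_prob_space)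
  have fin: "finite S" and le: "card S \<le> n"
    using S finite_subset card_mono[OF finite_lessThan S] by auto
  let ?F = "S \<rightarrow>\<^sub>E {..<n}" and ?I = "{f \<in> S \<rightarrow>\<^sub>E {..<n}. inj_on f S}"
  let ?c = "LINT M|\<mu>. mat_minor S id M * cnj (mat_minor S id M)"
  have fF: "finite ?F" using fin by (simp add: finite_PiE)
  have "fact (card S) = (LINT M|\<mu>. (\<Sum>f\<in>?F. mat_minor S f M * cnj (mat_minor S f M)))"
  proof -
    have "(LINT M|\<mu>. (\<Sum>f\<in>?F. mat_minor S f M * cnj (mat_minor S f M))) = (LINT M|\<mu>. fact (card S))"
    proof (intro Bochner_Integration.integral_cong refl)
      fix M assume "M \<in> space \<mu>"
      then have M: "M \<in> unitary_group n" by (simp add: space_haar_unitary[OF \<mu>])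
      show "(\<Sum>f\<in>?F. mat_minor S f M * cnj (mat_minor S f M)) = fact (card S)"
        using S by (intro sum_minor_mult_cnj[OF fin] unitary_group_columns[OF M]) auto
    qed
    then show ?thesis by (simp add: prob_space)
  qed
  also have "\<dots> = (\<Sum>f\<in>?F. LINT M|\<mu>. mat_minor S f M * cnj (mat_minor S f M))"
    using S by (intro Bochner_Integration.integral_sum integrable_minor_mult_cnj[OF \<mu>])
      (auto simp: PiE_def)
  also have "\<dots> = (\<Sum>f\<in>?I. ?c)"
  proof (rule sum.mono_neutral_cong_right[OF fF])
    show "\<forall>f\<in>?F - ?I. (LINT M|\<mu>. mat_minor S f M * cnj (mat_minor S f M)) = 0"
      using minor_eq_0[OF fin, where M = "\<lambda>i j. M $$ (i, j)" for M] by simp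
    show "(LINT M|\<mu>. mat_minor S f M * cnj (mat_minor S f M)) = ?c" if "f \<in> ?I" for f
      using that by (intro integral_minor_mult_cnj_inj[OF \<mu> S]) auto
  qed auto
  also have "\<dots> = of_nat (card ?I) * ?c" by simp
  finally have eq: "fact (card S) = of_nat (card ?I) * ?c" .
  have "card ?I = (\<Prod>i = 0..<card S. n - i)"
    using card_inj_on_subset_funcset[OF fin finite_lessThan[of n] subset_refl] by simp
  also have "of_nat \<dots> = (\<Prod>i = 0..<card S. of_nat n - of_nat i :: complex)"
    using le by (simp add: of_nat_diff)
  \<comment> \<open>The number of injections is the falling factorial of \<open>n\<close> of length
    \<open>card S\<close>; its factor \<open>fact (card S)\<close> cancels against the left side of
    \<open>eq\<close>.\<close>
  also have "\<dots> = fact (card S) * of_nat (n choose card S)"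
    by (simp add: gbinomial_mult_fact binomial_gbinomial)
  finally have "of_nat (card ?I) = (fact (card S) * of_nat (n choose card S) :: complex)" .
  with eq have "(of_nat (n choose card S) :: complex) * ?c = 1"
    by (simp add: mult.assoc)
  then show ?thesis
    using le by (simp add: field_simps)
qed

section \<open>Evaluation of the kernel\<close>

lemma mat_adjoint_mat_adjoint: "mat_adjoint (mat_adjoint A) = (A :: complex mat)"
proof -
  have "dim_row (mat_adjoint B) = dim_col B" "dim_col (mat_adjoint B) = dim_row B" for B :: "complex mat"
    by (simp_all add: mat_adjoint_def)
  then show ?thesis
    by (intro eq_matI) (auto simp: index_mat_adjoint)
qed

text \<open>\<open>\<Lambda>\<close> takes the adjoint of its argument, so minors of
  \<open>M\<close> itself belong to the adjoint of \<open>M\<close>. At \<open>M\<close> the minors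
  of the adjoint appear; they are conjugates of those of \<open>M\<close>, since transposition
  preserves minors.\<close>

lemma \<Lambda>_unitary:
  assumes M: "M \<in> unitary_group n"
  shows "\<Lambda> (mat_adjoint M) w = (\<Sum>S\<in>Pow {..<n}. (-w) ^ card S * mat_minor S id M)"
    and "\<Lambda> M z = (\<Sum>S\<in>Pow {..<n}. (-z) ^ card S * cnj (mat_minor S id M))"
proof -
  have c: "M \<in> carrier_mat n n" "mat_adjoint M \<in> carrier_mat n n"
    using M unitary_group_carrier mat_adjoint_carrier by blast+
  show "\<Lambda> (mat_adjoint M) w = (\<Sum>S\<in>Pow {..<n}. (-w) ^ card S * mat_minor S id M)"
    using c det_one_minus_smult[OF c(1)] by (simp add: \<Lambda>_def mat_adjoint_mat_adjoint)
  have "\<Lambda> M z = (\<Sum>S\<in>Pow {..<n}. (-z) ^ card S * minor S (\<lambda>i j. mat_adjoint M $$ (i, j)))"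
    using c det_one_minus_smult[OF c(2)] by (simp add: \<Lambda>_def)
  also have "\<dots> = (\<Sum>S\<in>Pow {..<n}. (-z) ^ card S * cnj (mat_minor S id M))"
  proof (intro sum.cong refl arg_cong2[where f = "(*)"])
    fix S assume "S \<in> Pow {..<n}"
    then have "minor S (\<lambda>i j. mat_adjoint M $$ (i, j)) = minor S (\<lambda>i j. cnj (M $$ (j, i)))"
      using c by (intro minor_cong) (auto simp: index_mat_adjoint subset_iff)
    also have "\<dots> = minor S (\<lambda>i j. cnj (M $$ (i, j)))"
      using \<open>S \<in> Pow {..<n}\<close> finite_subset by (intro minor_transpose) auto
    also have "\<dots> = cnj (mat_minor S id M)"
      by (simp add: minor_def)
    finally show "minor S (\<lambda>i j. mat_adjoint M $$ (i, j)) = cnj (mat_minor S id M)" .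
  qed
  finally show "\<Lambda> M z = (\<Sum>S\<in>Pow {..<n}. (-z) ^ card S * cnj (mat_minor S id M))" .
qed

text \<open>Orthogonality reduces the double sum over subsets to its diagonal. Each of the
  \<open>n choose k\<close> subsets of size \<open>k\<close> contributes
  \<open>cis (y - x) ^ k / (n choose k)\<close>.\<close>

lemma K_CUE_eq:
  assumes \<mu>: "haar_unitary n \<mu>"
  shows "K_CUE \<mu> x y = (\<Sum>k\<le>n. cis (y - x) ^ k)"
proof -
  let ?P = "Pow {..<n}" and ?z = "cis (- x)" and ?w = "cis y"
  have "K_CUE \<mu> x y = (LINT M|\<mu>. (\<Sum>T\<in>?P. \<Sum>S\<in>?P.
      ((- ?z) ^ card T * (- ?w) ^ card S) * (mat_minor S id M * cnj (mat_minor T id M))))"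
    unfolding K_CUE_def
    by (intro Bochner_Integration.integral_cong refl)
      (simp add: space_haar_unitary[OF \<mu>] \<Lambda>_unitary sum_product, simp add: mult_ac)
  also have "\<dots> = (\<Sum>T\<in>?P. \<Sum>S\<in>?P. ((- ?z) ^ card T * (- ?w) ^ card S) *
      (LINT M|\<mu>. mat_minor S id M * cnj (mat_minor T id M)))"
  proof -
    have int: "integrable \<mu> (\<lambda>M. c * (mat_minor S id M * cnj (mat_minor T id M)))"
      if "S \<in> ?P" "T \<in> ?P" for S T c
      using that by (intro integrable_mult_right integrable_minor_mult_cnj[OF \<mu>]) auto
    show ?thesis
      by (simp only: Bochner_Integration.integral_sum Bochner_Integration.integrable_sum int
          integral_mult_right_zero cong: sum.cong)
  qed
  also have "\<dots> = (\<Sum>T\<in>?P. \<Sum>S\<in>?P. if S = T then (- ?z) ^ card T * (- ?w) ^ card T / (n choose card T) else 0)"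
    using integral_minor_mult_cnj_self[OF \<mu>] integral_minor_mult_cnj_eq_0[OF \<mu>]
    by (intro sum.cong refl) auto
  \<comment> \<open>The minus signs of the two expansions cancel because both exponents are
    \<open>card T\<close>.\<close>
  also have "\<dots> = (\<Sum>T\<in>?P. cis (y - x) ^ card T / (n choose card T))"
    by (simp add: cis_mult flip: power_mult_distrib)
  also have "\<dots> = (\<Sum>k\<le>n. of_nat (n choose k) * (cis (y - x) ^ k / (n choose k)))"
    by (subst sum_Pow_card) auto
  also have "\<dots> = (\<Sum>k\<le>n. cis (y - x) ^ k)"
    by (intro sum.cong) auto
  finally show ?thesis .
qed

section \<open>Poles and Taylor coefficients on the unit circle\<close>

text \<open>Cauchy's formula for the \<open>k\<close>-th derivative at 0, with the unit circle
  parametrised by \<open>cis\<close>.\<close>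

lemma has_integral_Taylor_coefficient:
  fixes f :: "complex \<Rightarrow> complex"
  assumes "continuous_on (cball 0 1) f" "f holomorphic_on ball 0 1"
  shows "((\<lambda>x. f (cis x) * cis (- x) ^ k) has_integral 2 * pi * ((deriv ^^ k) f 0 / fact k)) {0..2 * pi}"
proof -
  have "((\<lambda>u. f u / (u - 0) ^ Suc k) has_contour_integral
      2 * pi * \<i> / fact k * (deriv ^^ k) f 0) (circlepath 0 1)"
    using assms by (rule Cauchy_has_contour_integral_higher_derivative_circlepath) simp
  then have "((\<lambda>t. f (0 + 1 * cis t) / (0 + 1 * cis t - 0) ^ Suc k * 1 * \<i> * cis t) has_integral
      2 * pi * \<i> / fact k * (deriv ^^ k) f 0) {0..2 * pi}"
    unfolding circlepath_def by (subst (asm) has_contour_integral_part_circlepath_iff) simp_all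
  \<comment> \<open>The factor \<open>- \<i>\<close> removes the \<open>\<i>\<close> in the
    derivative \<open>\<i> * cis t\<close> of the path; \<open>cis t\<close> cancels one of the
    \<open>Suc k\<close> powers.\<close>
  then have "((\<lambda>t. - \<i> * (f (0 + 1 * cis t) / (0 + 1 * cis t - 0) ^ Suc k * 1 * \<i> * cis t)) has_integral
      - \<i> * (2 * pi * \<i> / fact k * (deriv ^^ k) f 0)) {0..2 * pi}"
    by (rule has_integral_mult_right)
  also have "(\<lambda>t. - \<i> * (f (0 + 1 * cis t) / (0 + 1 * cis t - 0) ^ Suc k * 1 * \<i> * cis t)) =
      (\<lambda>x. f (cis x) * cis (- x) ^ k)"
    by (simp add: fun_eq_iff field_simps flip: cis_inverse)
  also have "- \<i> * (2 * pi * \<i> / fact k * (deriv ^^ k) f 0) = 2 * pi * ((deriv ^^ k) f 0 / fact k)"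
    by (simp add: field_simps)
  finally show ?thesis .
qed

text \<open>By compactness the domain of holomorphy contains a neighbourhood of the closed disc of
  uniform width \<open>e\<close>, hence the ball of radius \<open>1 + e\<close>.\<close>

lemma analytic_on_cball_imp_holomorphic_on_ball:
  assumes "f analytic_on cball 0 1"
  obtains r where "r > (1::real)" "f holomorphic_on ball (0 :: complex) r"
proof -
  obtain U where U: "open U" "cball 0 1 \<subseteq> U" "f holomorphic_on U"
    using assms unfolding analytic_on_holomorphic by blast
  obtain e where e: "e > 0" "(\<Union>z\<in>cball 0 1. ball z e) \<subseteq> U"
    using compact_subset_open_imp_ball_epsilon_subset[OF compact_cball U(1,2)] by blast
  have "z \<in> U" if z: "z \<in> ball 0 (1 + e)" for z
  proof (cases "norm z \<le> 1")
    case True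
    then show ?thesis using U(2) by auto
  next
    case False
    \<comment> \<open>Outside the closed disc, the radial projection \<open>sgn z\<close> lies on
      the circle at distance \<open>norm z - 1 < e\<close> from \<open>z\<close>.\<close>
    have "z = complex_of_real (norm z) * sgn z"
      using False by (auto simp: sgn_eq)
    then have "sgn z - z = complex_of_real (1 - norm z) * sgn z"
      by (metis left_diff_distrib mult_1 of_real_1 of_real_diff)
    then have "dist (sgn z) z = norm z - 1"
      using False by (cases "z = 0") (simp_all add: dist_norm norm_mult norm_sgn del: of_real_diff)
    then have "z \<in> ball (sgn z) e" "sgn z \<in> cball 0 1"
      using z by (auto simp: norm_sgn)
    then show ?thesis using e(2) by blast
  qed
  then show thesis
    using e(1) by (intro that[of "1 + e"] holomorphic_on_subset[OF U(3)]) auto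
qed

section \<open>Poles on the circle destroy integrability\<close>

text \<open>The integral of \<open>c / (x - a)\<close> over \<open>{p..b}\<close> grows
  logarithmically without bound as \<open>p\<close> decreases to \<open>a\<close>.\<close>

lemma not_set_integrable_if_ge_inverse:
  fixes g :: "real \<Rightarrow> 'a :: euclidean_space"
  assumes c: "c > 0" and ab: "a < b"
    and bound: "\<And>x. a < x \<Longrightarrow> x \<le> b \<Longrightarrow> c / (x - a) \<le> norm (g x)"
  shows "\<not> set_integrable lborel {a..b} g"
proof
  assume "set_integrable lborel {a..b} g"
  then have ng: "set_integrable lborel {a..b} (\<lambda>x. norm (g x))"
    by (rule set_integrable_norm)
  define B where "B = integral {a..b} (\<lambda>x. norm (g x))"
  \<comment> \<open>Chosen so that the integral of \<open>c / (x - a)\<close> from \<open>p\<close>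
    to \<open>b\<close>, namely \<open>- c * ln q\<close>, equals \<open>\<bar>B\<bar> + 1\<close>
    and exceeds \<open>B\<close>.\<close>
  define q where "q = exp (- ((\<bar>B\<bar> + 1) / c))"
  define p where "p = a + (b - a) * q"
  have q: "0 < q" "q \<le> 1" "c * ln q = - (\<bar>B\<bar> + 1)"
    using c by (auto simp: q_def)
  have "(b - a) * q \<le> b - a"
    using q(2) ab by (simp add: mult_left_le)
  then have p: "a < p" "p \<le> b"
    using mult_pos_pos[of "b - a" q] q(1) ab unfolding p_def by linarith+
  have "((\<lambda>x. c / (x - a)) has_integral c * ln (b - a) - c * ln (p - a)) {p..b}"
    using p by (intro fundamental_theorem_of_calculus)
      (auto intro!: derivative_eq_intros simp flip: has_real_derivative_iff_has_vector_derivative)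
  moreover have int: "(\<lambda>x. norm (g x)) integrable_on {p..b}"
    using p by (intro set_borel_integral_eq_integral(1) set_integrable_subset[OF ng]) auto
  ultimately have "c * ln (b - a) - c * ln (p - a) \<le> integral {p..b} (\<lambda>x. norm (g x))"
    using p bound by (intro has_integral_le[OF _ integrable_integral]) auto
  also have "\<dots> \<le> B"
    unfolding B_def using p int set_borel_integral_eq_integral(1)[OF ng]
    by (intro integral_subset_le) auto
  also have "c * ln (b - a) - c * ln (p - a) = \<bar>B\<bar> + 1"
    using ab q by (simp add: p_def ln_mult distrib_left)
  finally show False by simp
qed

text \<open>A chord is no longer than its arc: its length is twice the absolute sine of half the
  angle.\<close>

lemma norm_cis_diff_le: "norm (cis x - cis t) \<le> \<bar>x - t\<bar>"
proof -
  have "cis x - cis t = cis t * (exp (\<i> * complex_of_real (x - t)) - 1)"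
    unfolding cis_conv_exp[symmetric] by (simp add: right_diff_distrib cis_mult)
  then have "norm (cis x - cis t) = 2 * \<bar>sin ((x - t) / 2)\<bar>"
    by (simp only: norm_mult norm_cis dist_exp_i_1)
  also have "\<dots> \<le> 2 * \<bar>(x - t) / 2\<bar>"
    by (intro mult_left_mono abs_sin_x_le_abs_x) auto
  finally show ?thesis by simp
qed

text \<open>The reciprocal of \<open>f\<close> extends holomorphically by 0 to the pole. Its
  difference quotient there is bounded, so it is at most a constant times
  \<open>norm (w - z)\<close>.\<close>

lemma is_pole_imp_norm_ge_inverse:
  assumes f: "f meromorphic_on {z}" and pole: "is_pole f z"
  obtains c where "c > 0" "eventually (\<lambda>w. c / norm (w - z) \<le> norm (f w)) (at z)"
proof -
  have "isolated_singularity_at f z"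
    using f by (auto intro: meromorphic_on_isolated_singularity)
  then obtain r where r: "r > 0" "f analytic_on ball z r - {z}"
    unfolding isolated_singularity_at_def by blast
  have "eventually (\<lambda>w. f w \<noteq> 0) (at z)"
    using pole by (rule non_zero_neighbour_pole)
  then obtain d where d: "d > 0" "\<And>w. w \<noteq> z \<Longrightarrow> dist w z < d \<Longrightarrow> f w \<noteq> 0"
    unfolding eventually_at by auto
  define h where "h = (\<lambda>w. if w = z then 0 else inverse (f w))"
  have "h holomorphic_on ball z (min r d)"
    unfolding h_def
  proof (rule is_pole_inverse_holomorphic[OF open_ball _ pole])
    show "f holomorphic_on ball z (min r d) - {z}"
      using analytic_imp_holomorphic[OF r(2)] by (rule holomorphic_on_subset) auto
  qed (use d(2) in \<open>auto simp: dist_commute\<close>)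
  then have "(h has_field_derivative deriv h z) (at z)"
    using r(1) d(1) by (intro holomorphic_derivI[OF _ open_ball]) auto
  then have "((\<lambda>w. norm ((h w - h z) / (w - z))) \<longlongrightarrow> norm (deriv h z)) (at z)"
    unfolding has_field_derivative_iff by (rule tendsto_norm)
  \<comment> \<open>Adding 1 makes the bound strict and keeps it positive when the derivative
    vanishes, as at a multiple pole.\<close>
  then have "eventually (\<lambda>w. norm ((h w - h z) / (w - z)) < norm (deriv h z) + 1) (at z)"
    by (rule order_tendstoD) simp
  moreover have "eventually (\<lambda>w. w \<noteq> z) (at z)"
    by (rule eventually_neq_at_within)
  ultimately have "eventually (\<lambda>w. (1 / (norm (deriv h z) + 1)) / norm (w - z) \<le> norm (f w)) (at z)"
    using \<open>eventually (\<lambda>w. f w \<noteq> 0) (at z)\<close>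
  proof eventually_elim
    case (elim w)
    then have "1 / (norm (f w) * norm (w - z)) < norm (deriv h z) + 1"
      by (simp add: h_def norm_mult norm_divide norm_inverse divide_inverse)
    moreover have "norm (f w) * norm (w - z) > 0" "norm (w - z) > 0" "norm (deriv h z) + 1 > 0"
      using elim by (auto intro: add_nonneg_pos)
    ultimately show ?case
      by (simp add: divide_simps mult_ac)
  qed
  then show thesis
    by (intro that[of "1 / (norm (deriv h z) + 1)"]) (auto intro: add_nonneg_pos)
qed

text \<open>Just to the right of \<open>t\<close>, \<open>K\<close> stays away from 0 and
  \<open>f (cis x)\<close> is at least a constant over \<open>x - t\<close>, since the chord is at
  most the arc. Requiring \<open>t < b\<close> leaves room on that side.\<close>

lemma pole_not_set_integrable:
  fixes K :: "real \<Rightarrow> complex"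
  assumes f: "f meromorphic_on {cis t}" and pole: "is_pole f (cis t)"
    and t: "t \<in> {a..<b}" and K: "isCont K t" "K t \<noteq> 0"
  shows "\<not> set_integrable lborel {a..b} (\<lambda>x. f (cis x) * K x)"
proof
  assume int: "set_integrable lborel {a..b} (\<lambda>x. f (cis x) * K x)"
  obtain c where c: "c > 0" "eventually (\<lambda>w. c / norm (w - cis t) \<le> norm (f w)) (at (cis t))"
    using is_pole_imp_norm_ge_inverse[OF f pole] .
  obtain d where d: "d > 0"
    "\<And>w. w \<noteq> cis t \<Longrightarrow> dist w (cis t) < d \<Longrightarrow> c / norm (w - cis t) \<le> norm (f w)"
    using c(2) unfolding eventually_at by auto
  have "((\<lambda>x. norm (K x)) \<longlongrightarrow> norm (K t)) (at t)"
    using K(1) by (intro tendsto_norm) (simp add: isCont_def)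
  then have "eventually (\<lambda>x. norm (K x) > norm (K t) / 2) (at t)"
    using K(2) by (intro order_tendstoD) auto
  then obtain e where e: "e > 0"
    "\<And>x. x \<noteq> t \<Longrightarrow> dist x t < e \<Longrightarrow> norm (K x) > norm (K t) / 2"
    unfolding eventually_at by auto
  \<comment> \<open>Halving \<open>d\<close> and \<open>e\<close> keeps the endpoint strictly inside
    both neighbourhoods; \<open>t + 1\<close> keeps \<open>x - t\<close> below \<open>pi\<close>, so
    that \<open>cis x\<close> differs from \<open>cis t\<close>.\<close>
  define s where "s = Min {b, t + d / 2, t + e / 2, t + 1}"
  have s: "t < s" "s \<le> b" "s < t + d" "s < t + e" "s \<le> t + 1"
    using t d(1) e(1) by (auto simp: s_def min_def)
  have "\<not> set_integrable lborel {t..s} (\<lambda>x. f (cis x) * K x)"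
  proof (rule not_set_integrable_if_ge_inverse)
    show "c * (norm (K t) / 2) > 0" using c K(2) by simp
    fix x assume x: "t < x" "x \<le> s"
    have "cis x \<noteq> cis t"
    proof
      assume "cis x = cis t"
      then have "cis (x - t) = 1" by (metis cis_divide cis_neq_zero divide_self)
      then have "cos (x - t) = 1" by (simp add: complex_eq_iff)
      moreover have "cos (x - t) < cos 0"
        using x s(5) pi_gt3 by (intro cos_monotone_0_pi) auto
      ultimately show False by simp
    qed
    then have pos: "norm (cis x - cis t) > 0" by simp
    have le: "norm (cis x - cis t) \<le> x - t"
      using norm_cis_diff_le[of x t] x by simp
    have "c / (x - t) \<le> c / norm (cis x - cis t)"
      using le pos c x by (intro divide_left_mono mult_pos_pos) auto
    also have "\<dots> \<le> norm (f (cis x))"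
      using \<open>cis x \<noteq> cis t\<close> le x s by (intro d(2)) (auto simp: dist_norm)
    finally have "c / (x - t) * (norm (K t) / 2) \<le> norm (f (cis x)) * norm (K x)"
      using e(2)[of x] x s c by (intro mult_mono) (auto simp: dist_real_def less_imp_le)
    then show "c * (norm (K t) / 2) / (x - t) \<le> norm (f (cis x) * K x)"
      by (simp add: norm_mult algebra_simps)
  qed (use s in auto)
  moreover have "set_integrable lborel {t..s} (\<lambda>x. f (cis x) * K x)"
    using t s by (intro set_integrable_subset[OF int]) auto
  ultimately show False by simp
qed

text \<open>At a pole \<open>cis t\<close>, integrability forces the kernel sum to vanish at
  \<open>t\<close> for all large \<open>n\<close>, which cannot happen for two consecutive values of
  \<open>n\<close>.\<close>

lemma no_pole_on_unit_circle:
  assumes f: "f meromorphic_on UNIV" and z: "norm z = 1"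
    and int: "eventually (\<lambda>N. set_integrable lborel {0..2 * pi}
      (\<lambda>x. f (cis x) * (\<Sum>k\<le>N. cis (y - x) ^ k))) sequentially"
  shows "\<not> is_pole f z"
proof
  assume pole: "is_pole f z"
  define t where "t = Arg2pi z"
  \<comment> \<open>\<open>Arg2pi\<close> gives an angle below \<open>2 * pi\<close>, so the
    interval extends to the right of \<open>t\<close>.\<close>
  have t: "z = cis t" "t \<in> {0..<2 * pi}"
    using Arg2pi_eq[of z] Arg2pi[of z] z by (auto simp: t_def cis_conv_exp)
  obtain N where N: "\<And>n. n \<ge> N \<Longrightarrow> set_integrable lborel {0..2 * pi}
      (\<lambda>x. f (cis x) * (\<Sum>k\<le>n. cis (y - x) ^ k))"
    using int unfolding eventually_sequentially by blast
  have "(\<Sum>k\<le>n. cis (y - t) ^ k) = 0" if "n \<ge> N" for n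
  proof (rule ccontr)
    assume "(\<Sum>k\<le>n. cis (y - t) ^ k) \<noteq> 0"
    moreover have "continuous_on UNIV (\<lambda>x. \<Sum>k\<le>n. cis (y - x) ^ k)"
      by (intro continuous_intros)
    then have "isCont (\<lambda>x. \<Sum>k\<le>n. cis (y - x) ^ k) t"
      by (simp add: continuous_on_eq_continuous_at)
    ultimately have "\<not> set_integrable lborel {0..2 * pi} (\<lambda>x. f (cis x) * (\<Sum>k\<le>n. cis (y - x) ^ k))"
      using pole t(2) unfolding t(1)
      by (intro pole_not_set_integrable[of f t] meromorphic_on_subset[OF f]) auto
    with N[OF that] show False by blast
  qed
  \<comment> \<open>The two sums differ by \<open>cis (y - t) ^ Suc N\<close>, which is
    nonzero.\<close>
  from this[of N] this[of "Suc N"] show False by simp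
qed

section \<open>The limit as convergence of a Taylor series\<close>

text \<open>\<open>nicely_meromorphic_on\<close> fixes the values of \<open>f\<close>: 0 at poles,
  the limit elsewhere. The Bochner integral of a non-integrable function is 0 by convention, so
  existence of the integrals for large \<open>N\<close> is stated as integrability.\<close>

theorem theorem5:
  fixes \<mu> :: "nat \<Rightarrow> complex mat measure"
    and f :: "complex \<Rightarrow> complex"
    and m :: nat and y :: real
  assumes haar: "\<And>N. haar_unitary N (\<mu> N)"
    and mero: "f nicely_meromorphic_on UNIV"
    and holo: "f holomorphic_on ball 0 1"
    and growth: "f \<in> o[at_infinity](\<lambda>z. of_real (norm z ^ (m + 1)))"
    and integrable: "\<forall>\<^sub>F N in sequentially.
      set_integrable lborel {0..2 * pi} (\<lambda>x. f (cis x) * K_CUE (\<mu> N) x y)"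
  shows "(\<lambda>N. LINT x:{0..2 * pi}|lborel. f (cis x) * K_CUE (\<mu> N) x y)
           \<longlonglongrightarrow> 2 * pi * f (cis y)"
proof -
  note K = K_CUE_eq[OF haar]
  have "\<not> is_pole f z" if "z \<in> cball 0 1" for z
  proof (cases "norm z = 1")
    case True
    then show ?thesis
      using no_pole_on_unit_circle[of f z y] mero integrable
      by (simp add: nicely_meromorphic_on_def K)
  next
    case False
    with that show ?thesis
      by (intro not_is_pole_holomorphic[OF open_ball _ holo]) auto
  qed
  \<comment> \<open>Away from poles the value of \<open>f\<close> is its limit, so no removable
    singularity remains.\<close>
  then have "f analytic_on {z}" if "z \<in> cball 0 1" for z
    using that by (intro nicely_meromorphic_on_imp_analytic_at[OF mero]) auto
  then have "f analytic_on cball 0 1"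
    using analytic_on_analytic_at by blast
  then obtain r where r: "r > 1" "f holomorphic_on ball 0 r"
    by (rule analytic_on_cball_imp_holomorphic_on_ball)
  then have cont: "continuous_on (cball 0 1) f"
    by (intro holomorphic_on_imp_continuous_on holomorphic_on_subset[OF r(2)]) auto
  define a where "a k = (deriv ^^ k) f 0 / fact k" for k
  have "(LINT x:{0..2 * pi}|lborel. f (cis x) * K_CUE (\<mu> N) x y) = 2 * pi * (\<Sum>k\<le>N. a k * cis y ^ k)" for N
  proof -
    have expand: "(\<lambda>x. f (cis x) * K_CUE (\<mu> N) x y) = (\<lambda>x. \<Sum>k\<le>N. f (cis x) * cis (- x) ^ k * cis y ^ k)"
    proof
      fix x
      have "cis (y - x) = cis (- x) * cis y" by (simp add: cis_mult)
      then show "f (cis x) * K_CUE (\<mu> N) x y = (\<Sum>k\<le>N. f (cis x) * cis (- x) ^ k * cis y ^ k)"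
        by (simp only: K sum_distrib_left power_mult_distrib mult.assoc)
    qed
    have "continuous_on {0..2 * pi} (\<lambda>x. f (cis x) * K_CUE (\<mu> N) x y)"
      unfolding K by (intro continuous_intros continuous_on_compose2[OF cont]) auto
    then have "(LINT x:{0..2 * pi}|lborel. f (cis x) * K_CUE (\<mu> N) x y) =
        integral {0..2 * pi} (\<lambda>x. f (cis x) * K_CUE (\<mu> N) x y)"
      by (intro set_borel_integral_eq_integral(2) borel_integrable_atLeastAtMost')
    also have "\<dots> = (\<Sum>k\<le>N. 2 * pi * a k * cis y ^ k)"
      unfolding a_def expand
      by (intro integral_unique has_integral_sum has_integral_mult_left
          has_integral_Taylor_coefficient[OF cont holo]) auto
    finally show ?thesis by (simp add: sum_distrib_left mult.assoc)
  qed
  \<comment> \<open>Since \<open>r > 1\<close>, the point \<open>cis y\<close> is interior to the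
    disc of convergence.\<close>
  moreover have "(\<lambda>k. a k * (cis y - 0) ^ k) sums f (cis y)"
    unfolding a_def using r by (intro holomorphic_power_series[OF r(2)]) auto
  then have "(\<lambda>N. 2 * pi * (\<Sum>k\<le>N. a k * cis y ^ k)) \<longlonglongrightarrow> 2 * pi * f (cis y)"
    unfolding sums_def_le by (intro tendsto_mult_left) simp
  ultimately show ?thesis by simp
qed

end
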